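(* Any fundamental line complex $\mathsf{l}$ in $\mathbb{CP}^3$ (in general position) gives rise to a solution $\mathcal{M}$ of the $M$-system with $N=3$ and upper indices $\{1,2,3,4,5\}$ via the lift $\mathsf{a}\wedge\mathsf{b}$ of the lines $\mathsf{l}$. That is: let $M^{44},M^{45},M^{54},M^{55}:\mathbb{Z}^3\to\mathbb{C}$ be the functions such that, at every point of $\mathbb{Z}^3$, $\mathsf{l}$ is the line through the points with homogeneous coordinates $$\mathsf{a}=\begin{pmatrix}0\\ 1\\ M^{44}\\ M^{54}\end{pmatrix},\qquad \mathsf{b}=\begin{pmatrix}-1\\ 0\\ M^{45}\\ M^{55}\end{pmatrix}.$$ Then, there exist functions $M^{ik}:\mathbb{Z}^3\to\mathbb{C}$ for the remaining pairs $(i,k)\in\{1,\dots,5\}^2$ such that $\mathcal{M}=(M^{ik})_{i,k=1,\dots,5}$ is a solution of the $M$-system.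
   Context: Notation: for a function $f$ on $\mathbb{Z}^3$ the argument is suppressed, and lower indices denote unit shifts: $f=f(n_1,n_2,n_3)$, $f_1=f(n_1+1,n_2,n_3)$, $f_{23}=f(n_1,n_2+1,n_3+1)$, etc. All relations hold at every point of $\mathbb{Z}^3$. $M$-system ($N=3$, upper indices $\{1,2,3,4,5\}$): functions $M^{ik}:\mathbb{Z}^3\to\mathbb{C}$, $i,k\in\{1,\dots,5\}$, with $M^{ll}\neq 0$ for $l\in\{1,2,3\}$, obeying $$M^{ik}_l=M^{ik}-\frac{M^{il}M^{lk}}{M^{ll}},\qquad l\in\{1,2,3\}\setminus\{i,k\}.$$ Fundamental line complex in $\mathbb{CP}^3$: a map $\mathsf{l}:\mathbb{Z}^3\to\{\text{lines in }\mathbb{CP}^3\}$ such that any neighbouring lines $\mathsf{l}$ and $\mathsf{l}_l$, $l\in\{1,2,3\}$, intersect and the points of intersection $\mathsf{p}^l=\mathsf{l}\cap\mathsf{l}_l$ enjoy the coplanarity property: for any distinct $l,m,p\in\{1,2,3\}$, the four points $\mathsf{p}^l,\mathsf{p}^l_m,\mathsf{p}^l_{mp},\mathsf{p}^l_p$ are coplanar. (Generically, this is equivalent to the concurrency property: for any distinct $l,m,p$, the four lines connecting the points $\mathsf{p}^l,\mathsf{p}^p,\mathsf{p}^l_p,\mathsf{p}^p_l$ with their shifted counterparts $\mathsf{p}^l_m,\mathsf{p}^p_m,\mathsf{p}^l_{pm},\mathsf{p}^p_{lm}$, respectively, are concurrent.) Standing genericity: the line complex is assumed to be in general position subject to the required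 incidences. In particular, neighbouring lines are distinct; for each elementary cube, the points of intersection on a given line which are attached to different edges are distinct; the four lines $\mathsf{l},\mathsf{l}_l,\mathsf{l}_m,\mathsf{l}_{lm}$ attached to any face are not contained in a plane; and no line of the complex meets the line $\{x^0=x^1=0\}$, where $(x^0,x^1,x^2,x^3)$ are the homogeneous coordinates of $\mathbb{CP}^3$, so that the normalised points $\mathsf{a},\mathsf{b}$ with homogeneous coordinates of the form $\mathsf{a}=(0,1,M^{44},M^{54})^T$ and $\mathsf{b}=(-1,0,M^{45},M^{55})^T$ exist and are unique on every line. *)

theory Defs
  imports "HOL-Analysis.Analysis"
begin

type_synonym lattice = "int \<times> int \<times> int"

definition shift :: "nat \<Rightarrow> lattice \<Rightarrow> lattice" where
  "shift l = (\<lambda>(n1, n2, n3). (n1 + of_bool (l = 1), n2 + of_bool (l = 2), n3 + of_bool (l = 3)))"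

definition M_system :: "(nat \<Rightarrow> nat \<Rightarrow> lattice \<Rightarrow> complex) \<Rightarrow> bool" where
  "M_system M \<longleftrightarrow>
     (\<forall>l\<in>{1,2,3}. \<forall>n. M l l n \<noteq> 0) \<and>
     (\<forall>i\<in>{1..5}. \<forall>k\<in>{1..5}. \<forall>l\<in>{1,2,3} - {i, k}. \<forall>n.
        M i k (shift l n) = M i k n - M i l n * M l k n / M l l n)"

text \<open>
  A projective subspace of \<open>CP\<^sup>3\<close> is identified with the complex-linear subspace of \<open>C\<^sup>4\<close> of one
  dimension more, so that incidence is inclusion and the point of intersection of two lines is
  their set-theoretic intersection. The \<open>vec\<close> notions are those of the complex vector space,
  whereas the unqualified \<open>subspace\<close>, \<open>dim\<close> and \<open>span\<close> would be real-linear.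
  The homogeneous coordinates \<open>x\<^sup>0, x\<^sup>1, x\<^sup>2, x\<^sup>3\<close> are the components \<open>x $ 1, x $ 2, x $ 3, x $ 4\<close>.
\<close>

definition proj_point :: "(complex ^ 4) set \<Rightarrow> bool" where
  "proj_point U \<longleftrightarrow> vec.subspace U \<and> vec.dim U = 1"

definition proj_line :: "(complex ^ 4) set \<Rightarrow> bool" where
  "proj_line U \<longleftrightarrow> vec.subspace U \<and> vec.dim U = 2"

definition proj_plane :: "(complex ^ 4) set \<Rightarrow> bool" where
  "proj_plane U \<longleftrightarrow> vec.subspace U \<and> vec.dim U = 3"

definition coplanar_subspaces :: "(complex ^ 4) set set \<Rightarrow> bool" where
  "coplanar_subspaces \<U> \<longleftrightarrow> (\<exists>E. proj_plane E \<and> (\<forall>U\<in>\<U>. U \<subseteq> E))"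

definition isect :: "(lattice \<Rightarrow> (complex ^ 4) set) \<Rightarrow> nat \<Rightarrow> lattice \<Rightarrow> (complex ^ 4) set" where
  "isect L l n = L n \<inter> L (shift l n)"

definition fundamental_line_complex :: "(lattice \<Rightarrow> (complex ^ 4) set) \<Rightarrow> bool" where
  "fundamental_line_complex L \<longleftrightarrow>
     (\<forall>n. proj_line (L n)) \<and>
     (\<forall>l\<in>{1,2,3}. \<forall>n. proj_point (isect L l n)) \<and>
     (\<forall>l\<in>{1,2,3}. \<forall>m\<in>{1,2,3}. \<forall>p\<in>{1,2,3}. l \<noteq> m \<and> m \<noteq> p \<and> l \<noteq> p \<longrightarrow>
        (\<forall>n. coplanar_subspaces
               {isect L l n, isect L l (shift m n),
                isect L l (shift p (shift m n)), isect L l (shift p n)}))"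

definition adjacent :: "lattice \<Rightarrow> lattice \<Rightarrow> bool" where
  "adjacent u v \<longleftrightarrow> (\<exists>l\<in>{1,2,3}. v = shift l u \<or> u = shift l v)"

definition cube :: "lattice \<Rightarrow> lattice set" where
  "cube = (\<lambda>(n1, n2, n3). {n1, n1 + 1} \<times> {n2, n2 + 1} \<times> {n3, n3 + 1})"

text \<open>
  In the second clause, \<open>u\<close> and \<open>w\<close> are the other ends of two different edges at the vertex \<open>v\<close>
  of the cube based at \<open>n\<close>. Points attached to opposite edges at \<open>v\<close>, which
  belong to no common cube, are not required to be distinct.
\<close>

definition general_position :: "(lattice \<Rightarrow> (complex ^ 4) set) \<Rightarrow> bool" where
  "general_position L \<longleftrightarrow>
     (\<forall>l\<in>{1,2,3}. \<forall>n. L n \<noteq> L (shift l n)) \<and>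
     (\<forall>n. \<forall>v\<in>cube n. \<forall>u\<in>cube n. \<forall>w\<in>cube n.
        adjacent v u \<and> adjacent v w \<and> u \<noteq> w \<longrightarrow> L v \<inter> L u \<noteq> L v \<inter> L w) \<and>
     (\<forall>l\<in>{1,2,3}. \<forall>m\<in>{1,2,3}. l \<noteq> m \<longrightarrow>
        (\<forall>n. \<not> coplanar_subspaces {L n, L (shift l n), L (shift m n), L (shift m (shift l n))})) \<and>
     (\<forall>n. L n \<inter> {x. x $ 1 = 0 \<and> x $ 2 = 0} = {0})"

definition normalised_lift ::
  "(lattice \<Rightarrow> (complex ^ 4) set) \<Rightarrow> (lattice \<Rightarrow> complex) \<Rightarrow> (lattice \<Rightarrow> complex) \<Rightarrow>
   (lattice \<Rightarrow> complex) \<Rightarrow> (lattice \<Rightarrow> complex) \<Rightarrow> bool" where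
  "normalised_lift L M44 M45 M54 M55 \<longleftrightarrow>
     (\<forall>n. L n = vec.span {vector [0, 1, M44 n, M54 n], vector [-1, 0, M45 n, M55 n]})"

end

theory Submission
  imports Defs
begin

text \<open>
  A line that avoids \<open>x\<^sup>0 = x\<^sup>1 = 0\<close> is the graph of a \<open>2 \<times> 2\<close> matrix \<open>D\<close>, whose entries are
  those of the normalised points. Its points are parametrised by their first two coordinates
  \<open>u\<close>, and the next line in direction \<open>l\<close> meets it in the point with parameter \<open>V\<^sup>l\<close> exactly if
  \<open>D\<^sub>l - D\<close> annihilates (a rotation of) \<open>V\<^sup>l\<close>, that is, \<open>D\<^sub>l = D - W\<^sup>l (V\<^sup>l)\<^sup>T\<close>. This has the form of
  the \<open>M\<close>-system for the upper indices 4 and 5, and the task is to scale \<open>V\<^sup>l\<close> and \<open>W\<^sup>l\<close> so that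
  the remaining relations hold.

  The vectors \<open>V\<^sup>l\<close> are scaled such that \<open>V\<^sup>l\<^sub>m = V\<^sup>l - c\<^sup>l\<^sup>m V\<^sup>m\<close>, that is,
  \<open>det (V\<^sup>l\<^sub>m, V\<^sup>m) = det (V\<^sup>l, V\<^sup>m)\<close>. Such a scaling exists if and only if the ratios of these two
  determinants, formed with arbitrary representatives, satisfy a closure condition on the
  \<open>(m, p)\<close>-faces. Coplanarity gives it, by the argument that proves the theorem of Menelaus
  (\<open>ratio_closed\<close>): a plane through the four points \<open>p\<^sup>l\<close> of the face is the kernel of a
  functional, which on each of the four lines is a multiple \<open>\<kappa>\<close> of \<open>det (\<cdot>, V\<^sup>l)\<close>. Comparing its
  values at the intersection points of neighbouring lines shows that the ratio along an edge
  is the quotient of the values of \<open>\<kappa>\<close> at its ends.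

  The rest is algebra (\<open>M_system_from_wave_functions\<close>). Computing \<open>V\<^sup>l\<^sub>m\<^sub>p\<close> in two ways leaves a
  relation between \<open>V\<^sup>m\<close> and \<open>V\<^sup>p\<close> only, which are linearly independent; hence the \<open>c\<^sup>l\<^sup>m\<close> solve the
  discrete Darboux system. Computing \<open>D\<^sub>l\<^sub>m\<close> in two ways yields in the same manner the linear
  equations for the \<open>W\<^sup>l\<close>. The Darboux system makes \<open>1 - c\<^sup>l\<^sup>m c\<^sup>m\<^sup>l\<close> closed, so that it is the quotient
  of a potential \<open>M\<^sup>l\<^sup>l\<close> along the \<open>m\<close>-edges; then \<open>M\<^sup>l\<^sup>m = c\<^sup>l\<^sup>m M\<^sup>m\<^sup>m\<close>, \<open>M\<^sup>l\<^sup>k = V\<^sup>l\<^sub>k\<close> and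
  \<open>M\<^sup>i\<^sup>l = M\<^sup>l\<^sup>l W\<^sup>l\<^sub>i\<close>. The potential vanishes nowhere because \<open>1 - c\<^sup>l\<^sup>m c\<^sup>m\<^sup>l\<close> is the quotient of
  \<open>det (V\<^sup>l\<^sub>m, V\<^sup>m\<^sub>l)\<close> by \<open>det (V\<^sup>l, V\<^sup>m)\<close>, and both express that two points on one line are distinct.
\<close>

section \<open>Potentials on the lattice\<close>

lemma nonzero_linear_recursion_int:
  fixes r :: "int \<Rightarrow> 'a :: field"
  assumes "\<And>i. r i \<noteq> 0"
  obtains A where "\<And>i. A i \<noteq> 0" "A 0 = 1" "\<And>i. A (i + 1) = r i * A i"
proof
  define A where "A i = (if i \<ge> 0 then (\<Prod>j\<in>{0..<i}. r j) else inverse (\<Prod>j\<in>{i..<0}. r j))" for i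
  have *: "{0..<i + 1} = insert i {0..<i}" if "i \<ge> 0" for i :: int
    using that by auto
  have **: "{i..<0} = insert i {i + 1..<0}" if "i < 0" for i :: int
    using that by auto
  show "A i \<noteq> 0" for i using assms by (simp add: A_def)
  show "A 0 = 1" by (simp add: A_def)
  show "A (i + 1) = r i * A i" for i
  proof (cases "i \<ge> 0")
    case True
    then show ?thesis by (simp add: A_def *)
  next
    case False
    then have "r i * A i = inverse (\<Prod>j\<in>{i + 1..<0}. r j)"
      using assms by (simp add: A_def **)
    also have "\<dots> = A (i + 1)"
      using False by (cases "i = -1") (auto simp: A_def)
    finally show ?thesis by simp
  qed
qed

text \<open>
  The recursion is solved along the line \<open>j = 0\<close> in the first direction and from there in
  the second direction. That the first recursion then holds for all \<open>j\<close> propagates from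
  \<open>j = 0\<close> both ways, because closedness relates it at \<open>j\<close> to itself at \<open>j + 1\<close>.
\<close>

lemma nonzero_potential_int2:
  fixes r s :: "int \<Rightarrow> int \<Rightarrow> 'a :: field"
  assumes r: "\<And>i j. r i j \<noteq> 0" and s: "\<And>i j. s i j \<noteq> 0"
    and closed: "\<And>i j. r i j * s (i + 1) j = s i j * r i (j + 1)"
  obtains g where "\<And>i j. g i j \<noteq> 0"
    "\<And>i j. g (i + 1) j = r i j * g i j" "\<And>i j. g i (j + 1) = s i j * g i j"
proof -
  obtain A where A: "\<And>i. A i \<noteq> 0" "\<And>i. A (i + 1) = r i 0 * A i"
    using nonzero_linear_recursion_int[of "\<lambda>i. r i 0"] r by metis
  have "\<exists>B. (\<forall>j. B j \<noteq> 0) \<and> B 0 = 1 \<and> (\<forall>j. B (j + 1) = s i j * B j)" for i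
    using nonzero_linear_recursion_int[of "s i"] s by metis
  then obtain B where B: "\<And>i j. B i j \<noteq> 0" "\<And>i. B i 0 = 1" "\<And>i j. B i (j + 1) = s i j * B i j"
    by metis
  have up: "r i 0 * B (i + 1) (j + 1) = r i (j + 1) * B i (j + 1) \<longleftrightarrow>
      r i 0 * B (i + 1) j = r i j * B i j" for i j
  proof -
    have left: "r i 0 * B (i + 1) (j + 1) = s (i + 1) j * (r i 0 * B (i + 1) j)"
      by (simp add: B)
    have right: "r i (j + 1) * B i (j + 1) = s (i + 1) j * (r i j * B i j)"
      using closed[of i j] by (simp add: B) algebra
    show ?thesis unfolding left right using s by simp
  qed
  have swap: "r i 0 * B (i + 1) j = r i j * B i j" for i j
  proof (induction j rule: int_induct[where k = 0])
    case base then show ?case by (simp add: B)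
  next
    case (step1 j) then show ?case using up by blast
  next
    case (step2 j) then show ?case using up[of i "j - 1"] by simp
  qed
  show thesis
  proof (rule that[of "\<lambda>i j. A i * B i j"])
    show "A (i + 1) * B (i + 1) j = r i j * (A i * B i j)" for i j
      using swap[of i j] by (simp add: A mult.commute mult.left_commute)
  qed (simp_all add: A B)
qed

lemma shift_commute: "shift l (shift m n) = shift m (shift l n)"
  by (simp add: shift_def split: prod.splits)

text \<open>
  The potential prescribed by its quotients in the two directions other than \<open>l\<close>; it is
  found separately on each layer of constant \<open>n\<^sub>l\<close>.
\<close>

lemma nonzero_potential:
  fixes r :: "nat \<Rightarrow> lattice \<Rightarrow> 'a :: field"
  assumes l: "l \<in> {1, 2, 3}"
    and nonzero: "\<And>m n. m \<in> {1, 2, 3} - {l} \<Longrightarrow> r m n \<noteq> 0"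
    and closed: "\<And>m p n. m \<in> {1, 2, 3} - {l} \<Longrightarrow> p \<in> {1, 2, 3} - {l, m} \<Longrightarrow>
      r m n * r p (shift m n) = r p n * r m (shift p n)"
  obtains g where "\<And>n. g n \<noteq> 0"
    "\<And>m n. m \<in> {1, 2, 3} - {l} \<Longrightarrow> g (shift m n) = r m n * g n"
proof -
  consider "l = 1" | "l = 2" | "l = 3" using l by auto
  then have "\<exists>g. (\<forall>n. g n \<noteq> 0) \<and>
      (\<forall>m n. m \<in> {1, 2, 3} - {l} \<longrightarrow> g (shift m n) = r m n * g n)"
  proof cases
    case 1
    have "\<exists>g. (\<forall>i j. g i j \<noteq> 0) \<and> (\<forall>i j. g (i + 1) j = r 2 (a, i, j) * g i j) \<and>
        (\<forall>i j. g i (j + 1) = r 3 (a, i, j) * g i j)" for a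
      using nonzero_potential_int2[of "\<lambda>i j. r 2 (a, i, j)" "\<lambda>i j. r 3 (a, i, j)"]
        nonzero closed[of 2 3 "(a, _, _)"] 1 by (simp add: shift_def) metis
    then obtain g where "\<And>a i j. g a i j \<noteq> 0" "\<And>a i j. g a (i + 1) j = r 2 (a, i, j) * g a i j"
        "\<And>a i j. g a i (j + 1) = r 3 (a, i, j) * g a i j"
      by metis
    then show ?thesis using 1
      by (intro exI[of _ "\<lambda>(a, i, j). g a i j"]) (auto simp: shift_def)
  next
    case 2
    have "\<exists>g. (\<forall>i j. g i j \<noteq> 0) \<and> (\<forall>i j. g (i + 1) j = r 1 (i, a, j) * g i j) \<and>
        (\<forall>i j. g i (j + 1) = r 3 (i, a, j) * g i j)" for a
      using nonzero_potential_int2[of "\<lambda>i j. r 1 (i, a, j)" "\<lambda>i j. r 3 (i, a, j)"]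
        nonzero closed[of 1 3 "(_, a, _)"] 2 by (simp add: shift_def) metis
    then obtain g where "\<And>a i j. g a i j \<noteq> 0" "\<And>a i j. g a (i + 1) j = r 1 (i, a, j) * g a i j"
        "\<And>a i j. g a i (j + 1) = r 3 (i, a, j) * g a i j"
      by metis
    then show ?thesis using 2
      by (intro exI[of _ "\<lambda>(i, a, j). g a i j"]) (auto simp: shift_def)
  next
    case 3
    have "\<exists>g. (\<forall>i j. g i j \<noteq> 0) \<and> (\<forall>i j. g (i + 1) j = r 1 (i, j, a) * g i j) \<and>
        (\<forall>i j. g i (j + 1) = r 2 (i, j, a) * g i j)" for a
      using nonzero_potential_int2[of "\<lambda>i j. r 1 (i, j, a)" "\<lambda>i j. r 2 (i, j, a)"]
        nonzero closed[of 1 2 "(_, _, a)"] 3 by (simp add: shift_def) metis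
    then obtain g where "\<And>a i j. g a i j \<noteq> 0" "\<And>a i j. g a (i + 1) j = r 1 (i, j, a) * g a i j"
        "\<And>a i j. g a i (j + 1) = r 2 (i, j, a) * g a i j"
      by metis
    then show ?thesis using 3
      by (intro exI[of _ "\<lambda>(i, j, a). g a i j"]) (auto simp: shift_def)
  qed
  then show thesis using that by blast
qed

section \<open>From wave functions to the M-system\<close>

text \<open>
  Vectors of the plane have their components indexed by 4 and 5, to agree with the upper
  indices of the \<open>M\<close>-system.
\<close>

definition det2 :: "(nat \<Rightarrow> complex) \<Rightarrow> (nat \<Rightarrow> complex) \<Rightarrow> complex" where
  "det2 u v = u 4 * v 5 - u 5 * v 4"

lemma det2_combination_zero:
  assumes "det2 u v \<noteq> 0" "x * u 4 + y * v 4 = 0" "x * u 5 + y * v 5 = 0"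
  shows "x = 0" "y = 0"
proof -
  have "x * det2 u v = (x * u 4 + y * v 4) * v 5 - (x * u 5 + y * v 5) * v 4"
    by (simp add: det2_def algebra_simps)
  then show "x = 0" using assms by simp
  have "y * det2 u v = u 4 * (x * u 5 + y * v 5) - u 5 * (x * u 4 + y * v 4)"
    by (simp add: det2_def algebra_simps)
  then show "y = 0" using assms by simp
qed

text \<open>
  What a line complex provides once the intersection points have been scaled: \<open>D n\<close> is the
  matrix of the line at \<open>n\<close>, and \<open>V l n\<close> the parameter of its intersection with the next line in
  direction \<open>l\<close>. The second group of conditions is the linear problem of the discrete Darboux
  system, together with the distinctness of the intersection points on the lines at \<open>n\<close> and
  at the opposite vertex of a face.
\<close>

definition wave_functions ::
  "(lattice \<Rightarrow> nat \<Rightarrow> nat \<Rightarrow> complex) \<Rightarrow> (nat \<Rightarrow> lattice \<Rightarrow> nat \<Rightarrow> complex) \<Rightarrow>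
   (nat \<Rightarrow> lattice \<Rightarrow> nat \<Rightarrow> complex) \<Rightarrow> (nat \<Rightarrow> nat \<Rightarrow> lattice \<Rightarrow> complex) \<Rightarrow> bool" where
  "wave_functions D V W c \<longleftrightarrow>
     (\<forall>l\<in>{1, 2, 3}. \<forall>n. \<forall>i\<in>{4, 5}. \<forall>k\<in>{4, 5}. D (shift l n) i k = D n i k - W l n i * V l n k) \<and>
     (\<forall>l\<in>{1, 2, 3}. \<forall>m\<in>{1, 2, 3} - {l}. \<forall>n.
        (\<forall>k\<in>{4, 5}. V l (shift m n) k = V l n k - c l m n * V m n k) \<and>
        det2 (V l n) (V m n) \<noteq> 0 \<and> det2 (V l (shift m n)) (V m (shift l n)) \<noteq> 0)"

text \<open>
  Two computations of \<open>V\<close> or \<open>D\<close> at a doubly shifted vertex differ by a combination of two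
  independent vectors, whose coefficients therefore vanish. This gives the evolution of \<open>W\<close> and \<open>c\<close>,
  and these are the \<open>M\<close>-system up to the diagonal entries, which are recovered as potentials.
\<close>

lemma M_system_from_wave_functions:
  assumes "wave_functions D V W c"
  obtains M where "M_system M"
    "\<And>i k n. i \<in> {4, 5} \<Longrightarrow> k \<in> {4, 5} \<Longrightarrow> M i k n = D n i k"
proof -
  have D: "\<And>l n i k. l \<in> {1, 2, 3} \<Longrightarrow> i \<in> {4, 5} \<Longrightarrow> k \<in> {4, 5} \<Longrightarrow>
      D (shift l n) i k = D n i k - W l n i * V l n k"
    and V: "\<And>l m n k. l \<in> {1, 2, 3} \<Longrightarrow> m \<in> {1, 2, 3} - {l} \<Longrightarrow> k \<in> {4, 5} \<Longrightarrow>
      V l (shift m n) k = V l n k - c l m n * V m n k"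
    and indep: "\<And>l m n. l \<in> {1, 2, 3} \<Longrightarrow> m \<in> {1, 2, 3} - {l} \<Longrightarrow> det2 (V l n) (V m n) \<noteq> 0"
    and indep': "\<And>l m n. l \<in> {1, 2, 3} \<Longrightarrow> m \<in> {1, 2, 3} - {l} \<Longrightarrow>
      det2 (V l (shift m n)) (V m (shift l n)) \<noteq> 0"
    using assms unfolding wave_functions_def by blast+
  define \<rho> where "\<rho> l m n = 1 - c l m n * c m l n" for l m n
  have rho_nonzero: "\<rho> l m n \<noteq> 0" if "l \<in> {1, 2, 3}" "m \<in> {1, 2, 3} - {l}" for l m n
  proof -
    have "det2 (V l (shift m n)) (V m (shift l n)) = \<rho> l m n * det2 (V l n) (V m n)"
    proof -
      have "V l (shift m n) k = V l n k - c l m n * V m n k"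
        "V m (shift l n) k = V m n k - c m l n * V l n k" if "k \<in> {4, 5}" for k
        using V[of l m k n] V[of m l k n] \<open>l \<in> _\<close> \<open>m \<in> _\<close> that by auto
      note this[of 4, simplified] this[of 5, simplified]
      then show ?thesis
        unfolding det2_def \<rho>_def by algebra
    qed
    then show ?thesis using indep'[OF that, of n] by (metis mult_zero_left)
  qed
  have W: "\<rho> l m n * W l (shift m n) i = W l n i - c m l n * W m n i"
    if lm: "l \<in> {1, 2, 3}" "m \<in> {1, 2, 3} - {l}" and i: "i \<in> {4, 5}" for l m n i
  proof -
    let ?x = "W l n i - W l (shift m n) i - c m l n * W m (shift l n) i"
    let ?y = "W m (shift l n) i - W m n i + c l m n * W l (shift m n) i"
    have eq: "?x * V l n k + ?y * V m n k = 0" if k: "k \<in> {4, 5}" for k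
    proof -
      have "D n i k - W m n i * V m n k - W l (shift m n) i * (V l n k - c l m n * V m n k)
          = D (shift l (shift m n)) i k"
        using D[of l i k "shift m n"] D[of m i k n] V[of l m k n] lm i k by auto
      also have "\<dots> = D n i k - W l n i * V l n k - W m (shift l n) i * (V m n k - c m l n * V l n k)"
        using D[of m i k "shift l n"] D[of l i k n] V[of m l k n] lm i k
        by (auto simp: shift_commute[of l m])
      finally show ?thesis by (simp add: algebra_simps)
    qed
    have "?x = 0" "?y = 0"
      by (rule det2_combination_zero[OF indep[OF lm, of n] eq eq]; simp)+
    moreover have "\<rho> l m n * W l (shift m n) i = W l n i - c m l n * W m n i - ?x - c m l n * ?y"
      by (simp add: \<rho>_def algebra_simps)
    ultimately show ?thesis by simp
  qed
  have c: "\<rho> m p n * c l p (shift m n) = c l p n - c l m n * c m p n"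
    if lmp: "l \<in> {1, 2, 3}" "m \<in> {1, 2, 3} - {l}" "p \<in> {1, 2, 3} - {l, m}" for l m p n
  proof -
    let ?x = "c l m n - c l m (shift p n) - c l p (shift m n) * c p m n"
    let ?y = "c l p (shift m n) - c l p n + c l m (shift p n) * c m p n"
    have eq: "?x * V m n k + ?y * V p n k = 0" if k: "k \<in> {4, 5}" for k
    proof -
      have "V l n k - c l m n * V m n k - c l p (shift m n) * (V p n k - c p m n * V m n k)
          = V l (shift p (shift m n)) k"
        using V[of l m k n] V[of l p k "shift m n"] V[of p m k n] lmp k by auto
      also have "\<dots> = V l n k - c l p n * V p n k - c l m (shift p n) * (V m n k - c m p n * V p n k)"
        using V[of l p k n] V[of l m k "shift p n"] V[of m p k n] lmp k
        by (auto simp: shift_commute[of p m])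
      finally show ?thesis by (simp add: algebra_simps)
    qed
    have "det2 (V m n) (V p n) \<noteq> 0" using indep lmp by auto
    then have "?x = 0" "?y = 0"
      by (rule det2_combination_zero[OF _ eq eq]; simp)+
    moreover have "\<rho> m p n * c l p (shift m n) = c l p n - c l m n * c m p n + ?y + c m p n * ?x"
      by (simp add: \<rho>_def algebra_simps)
    ultimately show ?thesis by simp
  qed
  have closed: "\<rho> l m n * \<rho> l p (shift m n) = \<rho> l p n * \<rho> l m (shift p n)"
    if lmp: "l \<in> {1, 2, 3}" "m \<in> {1, 2, 3} - {l}" "p \<in> {1, 2, 3} - {l, m}" for l m p n
  proof -
    have nz: "\<rho> m p n \<noteq> 0" using lmp by (intro rho_nonzero) auto
    have sym: "\<rho> a b n = \<rho> b a n" for a b by (simp add: \<rho>_def mult.commute)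
    \<comment> \<open>After multiplication by \<open>\<rho>\<^sup>m\<^sup>p\<close> both sides are the determinant of the \<open>3 \<times> 3\<close> matrix with
      unit diagonal and off-diagonal entries \<open>c\<close>, which is symmetric in \<open>m\<close> and \<open>p\<close>.\<close>
    let ?d = "1 - c l m n * c m l n - c m p n * c p m n - c l p n * c p l n
        + c l m n * c m p n * c p l n + c l p n * c p m n * c m l n"
    have *: "\<rho> b d n * (\<rho> l b n * \<rho> l d (shift b n))
        = \<rho> b d n * \<rho> l b n - (c l d n - c l b n * c b d n) * (c d l n - c d b n * c b l n)"
      if bd: "b \<in> {1, 2, 3} - {l}" "d \<in> {1, 2, 3} - {l, b}" for b d
    proof -
      have "\<rho> b d n * (\<rho> l b n * \<rho> l d (shift b n))
        = \<rho> b d n * \<rho> l b n - (\<rho> b d n * c l d (shift b n)) * (\<rho> b l n * c d l (shift b n))"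
        unfolding sym[of b l] by (simp add: \<rho>_def[of l d "shift b n"] algebra_simps)
      then show ?thesis using c[of l b d n] c[of d b l n] lmp(1) bd by auto
    qed
    have "\<rho> m p n * (\<rho> l m n * \<rho> l p (shift m n)) = ?d"
      using *[of m p] lmp by (simp add: \<rho>_def algebra_simps)
    moreover have "\<rho> m p n * (\<rho> l p n * \<rho> l m (shift p n)) = ?d"
      using *[of p m] lmp by (simp add: \<rho>_def algebra_simps)
    ultimately show ?thesis using nz by (metis mult_left_cancel)
  qed
  \<comment> \<open>The \<open>M\<close>-system with \<open>i = k = l\<close> reads \<open>M\<^sup>l\<^sup>l\<^sub>m = \<rho>\<^sup>l\<^sup>m M\<^sup>l\<^sup>l\<close> if \<open>M\<^sup>l\<^sup>m = c\<^sup>l\<^sup>m M\<^sup>m\<^sup>m\<close>.\<close>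
  have "\<exists>g. (\<forall>n. g n \<noteq> 0) \<and> (\<forall>m n. m \<in> {1, 2, 3} - {l} \<longrightarrow> g (shift m n) = \<rho> l m n * g n)"
    if l: "l \<in> {1, 2, 3}" for l
    using nonzero_potential[of l "\<rho> l"] rho_nonzero closed l by metis
  then obtain G where G_nonzero: "\<And>l n. l \<in> {1, 2, 3} \<Longrightarrow> G l n \<noteq> 0"
    and G: "\<And>l m n. l \<in> {1, 2, 3} \<Longrightarrow> m \<in> {1, 2, 3} - {l} \<Longrightarrow> G l (shift m n) = \<rho> l m n * G l n"
    by metis
  define M where "M i k n =
    (if i \<in> {1, 2, 3} then
       if k \<in> {1, 2, 3} then (if i = k then G k n else c i k n * G k n) else V i n k
     else if k \<in> {1, 2, 3} then G k n * W k n i else D n i k)" for i k n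
  have step: "M i k (shift l n) = M i k n - M i l n * M l k n / M l l n"
    if l: "l \<in> {1, 2, 3} - {i, k}" and i: "i \<in> {1..5}" and k: "k \<in> {1..5}" for i k l n
  proof -
    have M_ll: "M l l n = G l n" and nz: "G l n \<noteq> 0"
      using l by (simp_all add: M_def G_nonzero)
    have index: "j \<in> {4, 5}" if "j \<notin> {1, 2, 3}" "j \<in> {1..5}" for j :: nat
      using that by auto
    consider "i \<in> {1, 2, 3}" "i = k" | "i \<in> {1, 2, 3}" "k \<in> {1, 2, 3}" "i \<noteq> k"
      | "i \<in> {1, 2, 3}" "k \<in> {4, 5}" | "i \<in> {4, 5}" "k \<in> {1, 2, 3}" | "i \<in> {4, 5}" "k \<in> {4, 5}"
      using index i k by blast
    then show ?thesis
    proof cases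
      case 1
      have "M i k (shift l n) = \<rho> k l n * G k n" using 1 l G[of k l n] by (simp add: M_def)
      moreover have "M i l n * M l k n / M l l n = c k l n * c l k n * G k n"
        unfolding M_ll using 1 l nz by (simp add: M_def)
      moreover have "M i k n = G k n" using 1 by (simp add: M_def)
      ultimately show ?thesis by (simp add: \<rho>_def algebra_simps)
    next
      case 2
      have "M i k (shift l n) = (\<rho> k l n * c i k (shift l n)) * G k n"
        using 2 l G[of k l n] by (simp add: M_def)
      also have "\<rho> k l n * c i k (shift l n) = c i k n - c i l n * c l k n"
        using c[of i l k n] 2 l by (simp add: \<rho>_def mult.commute)
      finally have "M i k (shift l n) = (c i k n - c i l n * c l k n) * G k n" .
      moreover have "M i l n * M l k n / M l l n = c i l n * c l k n * G k n"
        unfolding M_ll using 2 l nz by (simp add: M_def)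
      moreover have "M i k n = c i k n * G k n" using 2 by (simp add: M_def)
      ultimately show ?thesis by (simp add: algebra_simps)
    next
      case 3
      have "M i k m = V i m k" for m using 3 by (auto simp: M_def)
      moreover have "M i l n * M l k n / M l l n = c i l n * V l n k"
        unfolding M_ll using 3 l nz by (auto simp: M_def)
      ultimately show ?thesis using V[of i l k n] 3 l by auto
    next
      case 4
      have M_ik: "M i k m = G k m * W k m i" for m using 4 by (auto simp: M_def)
      have "M i k (shift l n) = G k n * (\<rho> k l n * W k (shift l n) i)"
        using 4 l G[of k l n] unfolding M_ik by auto
      also have "\<rho> k l n * W k (shift l n) i = W k n i - c l k n * W l n i"
        using W[of k l i n] 4 l by auto
      finally have "M i k (shift l n) = G k n * (W k n i - c l k n * W l n i)" .
      moreover have "M i l n * M l k n / M l l n = G k n * (c l k n * W l n i)"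
        unfolding M_ll using 4 l nz by (auto simp: M_def)
      ultimately show ?thesis unfolding M_ik by (simp add: algebra_simps)
    next
      case 5
      have out: "i \<notin> {1, 2, 3}" "k \<notin> {1, 2, 3}" and l': "l \<in> {1, 2, 3}" using 5 l by auto
      have "M i k m = D m i k" for m using out by (simp add: M_def)
      moreover have "M i l n * M l k n / M l l n = W l n i * V l n k"
        unfolding M_ll using out l' nz by (simp add: M_def)
      ultimately show ?thesis using D[OF l' 5] by simp
    qed
  qed
  show thesis
  proof (rule that[of M])
    have "M l l n \<noteq> 0" if "l \<in> {1, 2, 3}" for l n using that G_nonzero by (simp add: M_def)
    then show "M_system M" using step unfolding M_system_def by blast
    show "M i k n = D n i k" if "i \<in> {4, 5}" "k \<in> {4, 5}" for i k n
      using that by (auto simp: M_def)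
  qed
qed

section \<open>Planes and normalised lines\<close>

lemma vector_4:
  "(vector [x, y, z, w] :: 'a::zero ^ 4) $ 1 = x"
  "(vector [x, y, z, w] :: 'a ^ 4) $ 2 = y"
  "(vector [x, y, z, w] :: 'a ^ 4) $ 3 = z"
  "(vector [x, y, z, w] :: 'a ^ 4) $ 4 = w"
  by (simp_all add: vector_def)

text \<open>
  A basis of the plane, extended by one vector, carries a linear map that is zero on the
  basis and not on the additional vector.
\<close>

lemma proj_plane_kernel:
  assumes "proj_plane E"
  obtains \<phi> :: "complex ^ 4 \<Rightarrow> complex" where
    "\<And>x y. \<phi> (x + y) = \<phi> x + \<phi> y" "\<And>a x. \<phi> (a *s x) = a * \<phi> x" "E = {x. \<phi> x = 0}"
proof -
  have E: "vec.subspace E" "vec.dim E = 3" using assms by (auto simp: proj_plane_def)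
  obtain B where B: "B \<subseteq> E" "vec.independent B" "E \<subseteq> vec.span B"
    using vec.basis_exists by metis
  have "E \<noteq> UNIV" using E(2) vec_dim_card[where 'a = complex and 'n = 4]  by auto
  then obtain z where z: "z \<notin> E" by auto
  have span_B: "vec.span B = E" using B E(1) by (meson vec.span_minimal subset_antisym)
  have "vec.independent (insert z B)"
    using B z span_B by (simp add: vec.independent_insert)
  then obtain g where g: "Vector_Spaces.linear (*s) (*s) g"
      and gB: "\<forall>x\<in>insert z B. g x = (if x = z then axis 1 1 else 0 :: complex ^ 4)"
    using vec.linear_independent_extend[of "insert z B" "\<lambda>x. if x = z then axis 1 1 else 0"] by blast
  interpret g: Vector_Spaces.linear "(*s)" "(*s)" g by (fact g)
  define \<phi> where "\<phi> x = g x $ 1" for x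
  show thesis
  proof (rule that)
    show add: "\<phi> (x + y) = \<phi> x + \<phi> y" for x y by (simp add: \<phi>_def g.add)
    show scale: "\<phi> (a *s x) = a * \<phi> x" for a x by (simp add: \<phi>_def g.scale)
    have ker: "vec.subspace {x. \<phi> x = 0}"
      unfolding vec.subspace_def using add scale scale[of 0 0] by auto
    have "\<phi> b = 0" if "b \<in> B" for b using gB that B z by (auto simp: \<phi>_def)
    then have sub: "E \<subseteq> {x. \<phi> x = 0}"
      using vec.span_minimal[OF _ ker, of B] span_B by blast
    have "\<phi> z = 1" using gB by (simp add: \<phi>_def axis_def)
    then have "z \<notin> {x. \<phi> x = 0}" by simp
    then have "{x. \<phi> x = 0} \<noteq> UNIV" by blast
    then have "vec.dim {x. \<phi> x = 0} \<noteq> 4"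
      using vec.subspace_dim_equal[OF ker vec.subspace_UNIV] vec_dim_card[where 'a = complex and 'n = 4] by auto
    moreover have "vec.dim {x. \<phi> x = 0} \<le> 4"
      using vec.dim_subset[of "{x. \<phi> x = 0}" UNIV] vec_dim_card[where 'a = complex and 'n = 4]
      by simp
    ultimately show "E = {x. \<phi> x = 0}"
      using vec.subspace_dim_equal[OF E(1) ker sub] E(2) by simp
  qed
qed

text \<open>
  The point \<open>u\<^sub>5 a - u\<^sub>4 b\<close> of the line through the normalised points \<open>a\<close> and \<open>b\<close>, so that
  \<open>u\<close> consists of its first two coordinates.
\<close>

definition line_point :: "(nat \<Rightarrow> nat \<Rightarrow> complex) \<Rightarrow> (nat \<Rightarrow> complex) \<Rightarrow> complex ^ 4" where
  "line_point D u = vector [u 4, u 5, D 4 4 * u 5 - D 4 5 * u 4, D 5 4 * u 5 - D 5 5 * u 4]"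

lemma line_point_eq_iff:
  "line_point D u = line_point D' u' \<longleftrightarrow> u 4 = u' 4 \<and> u 5 = u' 5 \<and>
     D 4 4 * u 5 - D 4 5 * u 4 = D' 4 4 * u' 5 - D' 4 5 * u' 4 \<and>
     D 5 4 * u 5 - D 5 5 * u 4 = D' 5 4 * u' 5 - D' 5 5 * u' 4"
  by (auto simp: line_point_def vec_eq_iff forall_4 vector_4)

lemma line_point_scale: "line_point D (\<lambda>k. a * u k) = a *s line_point D u"
  by (auto simp: line_point_def vec_eq_iff forall_4 vector_4 algebra_simps)

text \<open>
  Linear functionals on a two-dimensional space with a given zero are proportional, and
  \<open>\<lambda>u. det2 u v\<close> is one with the zero \<open>v\<close>.
\<close>

lemma line_point_functional:
  assumes "\<And>x y. \<phi> (x + y) = \<phi> x + \<phi> y" "\<And>a x. \<phi> (a *s x) = a * \<phi> x"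
    and "\<phi> (line_point D v) = 0" "line_point D v \<noteq> 0"
  obtains k where "\<And>u. \<phi> (line_point D u) = k * det2 u v"
proof -
  let ?a = "vector [0, 1, D 4 4, D 5 4] :: complex ^ 4"
  let ?b = "vector [1, 0, - D 4 5, - D 5 5] :: complex ^ 4"
  have "line_point D u = u 5 *s ?a + u 4 *s ?b" for u
    by (auto simp: line_point_def vec_eq_iff forall_4 vector_4 algebra_simps)
  then have \<phi>: "\<phi> (line_point D u) = u 5 * \<phi> ?a + u 4 * \<phi> ?b" for u
    using assms by simp
  have rel: "v 5 * \<phi> ?a = - (v 4 * \<phi> ?b)"
    using assms(3) unfolding \<phi> by (simp add: eq_neg_iff_add_eq_0)
  have "v 4 \<noteq> 0 \<or> v 5 \<noteq> 0"
    using assms(4) by (auto simp: line_point_def vec_eq_iff forall_4 vector_4)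
  then show thesis
  proof
    assume v: "v 4 \<noteq> 0"
    show thesis
      by (rule that[of "- \<phi> ?a / v 4"]) (use v rel in \<open>simp add: \<phi> det2_def field_simps\<close>)
  next
    assume v: "v 5 \<noteq> 0"
    show thesis
      by (rule that[of "\<phi> ?b / v 5"]) (use v rel in \<open>simp add: \<phi> det2_def field_simps\<close>)
  qed
qed

lemma span_line_point_eq:
  assumes "line_point D u \<noteq> 0" "line_point D w \<noteq> 0" "det2 u w = 0"
  shows "vec.span {line_point D u} = vec.span {line_point D w}"
proof -
  have *: "vec.span {line_point D w} \<subseteq> vec.span {line_point D u}"
    if nz: "line_point D u \<noteq> 0" and det: "det2 u w = 0" for u w
  proof -
    have "u 4 \<noteq> 0 \<or> u 5 \<noteq> 0"
      using nz by (auto simp: line_point_def vec_eq_iff forall_4 vector_4)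
    then have "\<exists>a. w 4 = a * u 4 \<and> w 5 = a * u 5"
    proof
      assume "u 4 \<noteq> 0"
      then show ?thesis using det by (intro exI[of _ "w 4 / u 4"]) (simp add: det2_def field_simps)
    next
      assume "u 5 \<noteq> 0"
      then show ?thesis using det by (intro exI[of _ "w 5 / u 5"]) (simp add: det2_def field_simps)
    qed
    then obtain a where "w 4 = a * u 4" "w 5 = a * u 5" by blast
    then have "line_point D w = a *s line_point D u"
      unfolding line_point_scale[symmetric] by (simp add: line_point_eq_iff)
    then show ?thesis
      using vec.span_minimal[of "{line_point D w}" "vec.span {line_point D u}"]
      by (simp add: vec.span_base vec.span_scale)
  qed
  have "det2 w u = 0" using assms(3) by (simp add: det2_def algebra_simps)
  then show ?thesis using *[of u w] *[of w u] assms by blast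
qed

lemma span_normalised_pair:
  "vec.span {vector [0, 1, D 4 4, D 5 4], vector [-1, 0, D 4 5, D 5 5]} = range (line_point D)"
proof -
  let ?a = "vector [0, 1, D 4 4, D 5 4] :: complex ^ 4"
  let ?b = "vector [-1, 0, D 4 5, D 5 5] :: complex ^ 4"
  have "line_point D u = u 5 *s ?a + (- u 4) *s ?b" for u
    by (auto simp: line_point_def vec_eq_iff forall_4 vector_4 algebra_simps)
  moreover have "u 5 *s ?a + (- u 4) *s ?b \<in> vec.span {?a, ?b}" for u :: "nat \<Rightarrow> complex"
    by (intro vec.span_add vec.span_scale vec.span_base) auto
  ultimately have "range (line_point D) \<subseteq> vec.span {?a, ?b}" by auto
  moreover have "vec.span {?a, ?b} \<subseteq> range (line_point D)"
  proof
    fix x assume "x \<in> vec.span {?a, ?b}"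
    then obtain s t where "x - s *s ?a - t *s ?b = 0"
      unfolding vec.span_breakdown_eq vec.span_empty by blast
    then have "x = s *s ?a + t *s ?b" by (simp add: algebra_simps)
    then have "x = line_point D (\<lambda>k. if k = 4 then - t else s)"
      by (auto simp: line_point_def vec_eq_iff forall_4 vector_4 algebra_simps)
    then show "x \<in> range (line_point D)" by blast
  qed
  ultimately show ?thesis by blast
qed

text \<open>
  Projection to the first two coordinates is injective on the line, hence bijective, and
  the normalised points are the preimages of \<open>(0, 1)\<close> and \<open>(-1, 0)\<close>.
\<close>

lemma proj_line_eq_range_line_point:
  assumes U: "proj_line U" and H: "U \<inter> {x. x $ 1 = 0 \<and> x $ 2 = 0} = {0}"
  shows "\<exists>D. U = range (line_point D)"
proof -
  have sub: "vec.subspace U" and dim: "vec.dim U = 2" using U by (auto simp: proj_line_def)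
  obtain B where B: "B \<subseteq> U" "vec.independent B" "card B = 2"
    using vec.basis_exists dim by metis
  then obtain x y where xy: "B = {x, y}" "x \<noteq> y" by (auto simp: card_2_iff)
  have x: "x \<in> U" and y: "y \<in> U" using B xy by auto
  have zero: "z = 0" if "z \<in> U" "z $ 1 = 0" "z $ 2 = 0" for z using that H by blast
  have comb: "s *s x + t *s y \<in> U" for s t
    using sub x y by (simp add: vec.subspace_add vec.subspace_scale)
  define d where "d = x $ 1 * y $ 2 - x $ 2 * y $ 1"
  have "d \<noteq> 0"
  proof
    assume "d = 0"
    then have "x $ 1 * y $ 2 = y $ 1 * x $ 2" "x $ 2 * y $ 1 = y $ 2 * x $ 1"
      by (simp_all add: d_def mult.commute)
    then have "(- y $ 1) *s x + (x $ 1) *s y = 0" "(- y $ 2) *s x + (x $ 2) *s y = 0"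
      by - (rule zero[OF comb]; simp add: mult.commute)+
    moreover have "s = 0 \<and> t = 0" if "s *s x + t *s y = 0" for s t
    proof -
      have "x \<notin> vec.span {y}" "y \<noteq> 0"
        using B(2) xy vec.independent_insert[of x "{y}"] vec.dependent_zero by auto
      have "s = 0"
      proof (rule ccontr)
        assume s: "s \<noteq> 0"
        have "s *s x = - (t *s y)" using that by (simp add: eq_neg_iff_add_eq_0)
        then have "inverse s *s (s *s x) = inverse s *s ((- t) *s y)" by simp
        then have "x = (inverse s * - t) *s y" using s by (simp add: vector_smult_assoc)
        then show False using \<open>x \<notin> vec.span {y}\<close> by (metis vec.span_base vec.span_scale singletonI)
      qed
      then show ?thesis using that \<open>y \<noteq> 0\<close> by simp
    qed
    ultimately have "x $ 1 = 0" "x $ 2 = 0" by blast+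
    then have "x = 0" using zero x by blast
    then show False using B(2) xy vec.dependent_zero by blast
  qed
  \<comment> \<open>Cramer's rule for the points with first two coordinates \<open>(0, 1)\<close> and \<open>(-1, 0)\<close>\<close>
  define a where "a = (- y $ 1 / d) *s x + (x $ 1 / d) *s y"
  define b where "b = (- y $ 2 / d) *s x + (x $ 2 / d) *s y"
  have aU: "a \<in> U" "b \<in> U" using comb by (simp_all only: a_def b_def)
  have a: "a $ 1 = 0" "a $ 2 = 1" and b: "b $ 1 = -1" "b $ 2 = 0"
    using \<open>d \<noteq> 0\<close> by (simp_all add: a_def b_def field_simps) (simp_all add: d_def algebra_simps)
  define D where "D i k = (if k = 4 then a else b) $ (if i = (4 :: nat) then 3 else 4)" for i and k :: nat
  have pt: "line_point D u = u 5 *s a + (- u 4) *s b" for u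
    by (simp add: line_point_def vec_eq_iff forall_4 vector_4 a b D_def algebra_simps)
  have "z \<in> range (line_point D)" if z: "z \<in> U" for z
  proof -
    let ?u = "\<lambda>k::nat. if k = 4 then z $ 1 else z $ 2"
    have "z - line_point D ?u = 0"
      unfolding pt using sub z aU
      by (intro zero vec.subspace_diff vec.subspace_add vec.subspace_scale) (simp_all add: a b)
    then show ?thesis by auto
  qed
  moreover have "line_point D u \<in> U" for u
    unfolding pt using sub aU by (intro vec.subspace_add vec.subspace_scale)
  ultimately show ?thesis by blast
qed

lemma range_line_point_inject:
  assumes "range (line_point D) = range (line_point D')" "i \<in> {4, 5}" "k \<in> {4, 5}"
  shows "D i k = D' i k"
proof -
  have "line_point D u = line_point D' u" for u
  proof -
    have "line_point D u \<in> range (line_point D')" using assms(1) by blast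
    then show ?thesis by (auto simp: line_point_eq_iff)
  qed
  from this[of "\<lambda>k. of_bool (k = 4)"] this[of "\<lambda>k. of_bool (k = 5)"] show ?thesis
    using assms(2,3) by (auto simp: line_point_eq_iff)
qed

text \<open>
  A common point of two lines annihilates the difference of their matrices, up to the
  rotation by a right angle that identifies a vector with the functional vanishing on it.
\<close>

lemma rank_one_difference:
  assumes "line_point D u = line_point D' u" "line_point D u \<noteq> 0"
  shows "\<exists>w. \<forall>i\<in>{4, 5}. \<forall>k\<in>{4, 5}. D' i k = D i k - w i * u k"
proof -
  have u: "u 4 \<noteq> 0 \<or> u 5 \<noteq> 0"
    using assms(2) by (auto simp: line_point_def vec_eq_iff forall_4 vector_4)
  have eq: "(D i 4 - D' i 4) * u 5 = (D i 5 - D' i 5) * u 4" if "i \<in> {4, 5}" for i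
    using assms(1) that by (auto simp: line_point_eq_iff algebra_simps)
  define w where "w i = (if u 4 \<noteq> 0 then (D i 4 - D' i 4) / u 4 else (D i 5 - D' i 5) / u 5)" for i
  have "D' i k = D i k - w i * u k" if "i \<in> {4, 5}" "k \<in> {4, 5}" for i k
    using u eq[OF that(1)] that(2) by (auto simp: w_def field_simps)
  then show ?thesis by blast
qed

lemma det2_eq_imp_shear:
  assumes "det2 v' w = det2 v w" "det2 v w \<noteq> 0"
  shows "\<exists>c. \<forall>k\<in>{4, 5}. v' k = v k - c * w k"
proof -
  have eq: "(v 4 - v' 4) * w 5 = (v 5 - v' 5) * w 4"
    using assms(1) by (simp add: det2_def algebra_simps)
  have "w 4 \<noteq> 0 \<or> w 5 \<noteq> 0" using assms(2) by (auto simp: det2_def)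
  then show ?thesis
  proof
    assume "w 4 \<noteq> 0"
    then show ?thesis using eq by (intro exI[of _ "(v 4 - v' 4) / w 4"]) (auto simp: field_simps)
  next
    assume "w 5 \<noteq> 0"
    then show ?thesis using eq by (intro exI[of _ "(v 5 - v' 5) / w 5"]) (auto simp: field_simps)
  qed
qed

section \<open>The wave functions of a line complex\<close>

locale lifted_line_complex =
  fixes L :: "lattice \<Rightarrow> (complex ^ 4) set" and D :: "lattice \<Rightarrow> nat \<Rightarrow> nat \<Rightarrow> complex"
  assumes fundamental: "fundamental_line_complex L"
    and generic: "general_position L"
    and lift: "L n = range (line_point (D n))"
begin

lemma proj_point_isect: "l \<in> {1, 2, 3} \<Longrightarrow> proj_point (isect L l n)"
  using fundamental unfolding fundamental_line_complex_def by blast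

lemma intersection_vector_exists:
  assumes "l \<in> {1, 2, 3}"
  shows "\<exists>u. isect L l n = vec.span {line_point (D n) u} \<and>
    line_point (D n) u = line_point (D (shift l n)) u"
proof -
  have sub: "vec.subspace (isect L l n)" and dim: "vec.dim (isect L l n) = 1"
    using proj_point_isect[OF assms, of n] by (simp_all add: proj_point_def)
  obtain B where B: "B \<subseteq> isect L l n" "isect L l n \<subseteq> vec.span B" "card B = 1"
    using vec.basis_exists dim by metis
  then obtain x where x: "B = {x}" by (auto simp: card_1_singleton_iff)
  have span: "isect L l n = vec.span {x}"
    using B x sub by (metis vec.span_minimal subset_antisym)
  have "x \<in> L n" "x \<in> L (shift l n)" using B x by (auto simp: isect_def)
  then obtain u u' where u: "x = line_point (D n) u" "x = line_point (D (shift l n)) u'"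
    using lift by blast
  then have "line_point (D (shift l n)) u = x" by (auto simp: line_point_eq_iff)
  then show ?thesis using u span by auto
qed

text \<open>
  A representative of the intersection point with the next line, scaled arbitrarily. Its
  parameter is the same on both lines, since it is read off from the first two coordinates.
\<close>

definition meet :: "nat \<Rightarrow> lattice \<Rightarrow> nat \<Rightarrow> complex" where
  "meet l n = (SOME u. isect L l n = vec.span {line_point (D n) u} \<and>
    line_point (D n) u = line_point (D (shift l n)) u)"

lemma
  assumes "l \<in> {1, 2, 3}"
  shows isect_meet: "isect L l n = vec.span {line_point (D n) (meet l n)}"
    and line_point_meet_shift: "line_point (D (shift l n)) (meet l n) = line_point (D n) (meet l n)"
  using someI_ex[OF intersection_vector_exists[OF assms, of n]] unfolding meet_def[symmetric] by auto

lemma line_point_meet_nonzero: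
  assumes "l \<in> {1, 2, 3}"
  shows "line_point (D n) (meet l n) \<noteq> 0"
proof
  assume "line_point (D n) (meet l n) = 0"
  then have "vec.dim (isect L l n) = 0"
    using isect_meet[OF assms, of n] vec.dim_eq_0 by (simp add: vec.dim_span)
  moreover have "vec.dim (isect L l n) = 1"
    using proj_point_isect[OF assms, of n] by (simp_all add: proj_point_def)
  ultimately show False by simp
qed

lemma points_distinct:
  assumes "v \<in> cube n" "u \<in> cube n" "w \<in> cube n" "adjacent v u" "adjacent v w" "u \<noteq> w"
  shows "L v \<inter> L u \<noteq> L v \<inter> L w"
  using generic assms unfolding general_position_def by blast

lemma face_in_cube:
  assumes "l \<in> {1, 2, 3}" "m \<in> {1, 2, 3} - {l}"
  shows "n \<in> cube n" "shift l n \<in> cube n" "shift m n \<in> cube n" "shift l (shift m n) \<in> cube n"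
  using assms by (cases n; auto simp: cube_def shift_def)+

lemma shift_neq:
  assumes "l \<in> {1, 2, 3}" "m \<in> {1, 2, 3} - {l}"
  shows "shift l n \<noteq> shift m n" "shift l (shift m n) \<noteq> n"
  using assms by (cases n; auto simp: shift_def)+

lemma adjacent_shift:
  assumes "l \<in> {1, 2, 3}"
  shows "adjacent n (shift l n)" "adjacent (shift l n) n"
  using assms by (auto simp: adjacent_def)

text \<open>
  Each determinant compares the points attached to the two edges of a face at one of its
  vertices: at \<open>n\<close>, at the neighbour in direction \<open>m\<close>, and at the opposite vertex.
\<close>

lemma
  assumes l: "l \<in> {1, 2, 3}" and m: "m \<in> {1, 2, 3} - {l}"
  shows det2_meet_meet: "det2 (meet l n) (meet m n) \<noteq> 0"
    and det2_meet_shift_meet: "det2 (meet l (shift m n)) (meet m n) \<noteq> 0"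
    and det2_meet_shift_meet_shift: "det2 (meet l (shift m n)) (meet m (shift l n)) \<noteq> 0"
proof -
  have m': "m \<in> {1, 2, 3}" using m by auto
  have independent: "det2 u w \<noteq> 0"
    if "A \<noteq> B" "A = vec.span {line_point D' u}" "B = vec.span {line_point D' w}"
      "line_point D' u \<noteq> 0" "line_point D' w \<noteq> 0" for A B D' u w
    using that span_line_point_eq by blast
  note nz_l = line_point_meet_nonzero[OF l] and nz_m = line_point_meet_nonzero[OF m']
  note in_cube = face_in_cube[OF l m, of n] and neq = shift_neq[OF l m, of n]
  note adj_l = adjacent_shift[OF l] and adj_m = adjacent_shift[OF m']
  have "isect L l n \<noteq> isect L m n"
    unfolding isect_def
    by (rule points_distinct[OF in_cube(1) in_cube(2) in_cube(3) adj_l(1) adj_m(1) neq(1)])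
  then show "det2 (meet l n) (meet m n) \<noteq> 0"
    using isect_meet[OF l] isect_meet[OF m'] nz_l nz_m by (rule independent)
  have "L (shift m n) \<inter> L (shift l (shift m n)) \<noteq> L (shift m n) \<inter> L n"
    by (rule points_distinct[OF in_cube(3) in_cube(4) in_cube(1) adj_l(1) adj_m(2) neq(2)])
  then have "isect L l (shift m n) \<noteq> isect L m n"
    by (simp add: isect_def Int_commute)
  then show "det2 (meet l (shift m n)) (meet m n) \<noteq> 0"
    using isect_meet[OF l]
  proof (rule independent)
    show "isect L m n = vec.span {line_point (D (shift m n)) (meet m n)}"
      using isect_meet[OF m'] by (simp add: line_point_meet_shift[OF m'])
    show "line_point (D (shift m n)) (meet m n) \<noteq> 0"
      using nz_m by (simp add: line_point_meet_shift[OF m'])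
  qed (rule nz_l)
  have "L (shift l (shift m n)) \<inter> L (shift m n) \<noteq> L (shift l (shift m n)) \<inter> L (shift l n)"
    by (rule points_distinct[OF in_cube(4) in_cube(3) in_cube(2) adj_l(2) _ neq(1)[symmetric]])
      (simp add: shift_commute[of l m] adj_m(2))
  then have "isect L l (shift m n) \<noteq> isect L m (shift l n)"
    by (simp add: isect_def shift_commute[of l m] Int_commute)
  then show "det2 (meet l (shift m n)) (meet m (shift l n)) \<noteq> 0"
  proof (rule independent)
    show "isect L l (shift m n) = vec.span {line_point (D (shift l (shift m n))) (meet l (shift m n))}"
      using isect_meet[OF l] by (simp add: line_point_meet_shift[OF l])
    show "isect L m (shift l n) = vec.span {line_point (D (shift l (shift m n))) (meet m (shift l n))}"
      using isect_meet[OF m'] by (simp add: line_point_meet_shift[OF m'] shift_commute[of l m])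
    show "line_point (D (shift l (shift m n))) (meet l (shift m n)) \<noteq> 0"
      using nz_l by (simp add: line_point_meet_shift[OF l])
    show "line_point (D (shift l (shift m n))) (meet m (shift l n)) \<noteq> 0"
      using nz_m by (simp add: line_point_meet_shift[OF m'] shift_commute[of l m])
  qed
qed

text \<open>
  The factor by which the representatives miss the normalisation
  \<open>det (V\<^sup>l\<^sub>m, V\<^sup>m) = det (V\<^sup>l, V\<^sup>m)\<close>.
\<close>

definition ratio :: "nat \<Rightarrow> nat \<Rightarrow> lattice \<Rightarrow> complex" where
  "ratio l m n = det2 (meet l (shift m n)) (meet m n) / det2 (meet l n) (meet m n)"

text \<open>
  The Menelaus argument, for the skew quadrilateral formed by the lines at the vertices of
  the face spanned by \<open>m\<close> and \<open>q\<close>. Its corners are the intersection points along the four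
  edges of the face, and the plane of the four points attached to the \<open>l\<close>-edges meets its sides
  in these points.
\<close>

lemma ratio_closed:
  assumes l: "l \<in> {1, 2, 3}" and m: "m \<in> {1, 2, 3} - {l}" and q: "q \<in> {1, 2, 3} - {l, m}"
  shows "ratio l m n * ratio l q (shift m n) = ratio l q n * ratio l m (shift q n)"
proof -
  let ?S = "{n, shift m n, shift q (shift m n), shift q n}"
  have "coplanar_subspaces {isect L l n, isect L l (shift m n),
      isect L l (shift q (shift m n)), isect L l (shift q n)}"
    by (rule fundamental[unfolded fundamental_line_complex_def, THEN conjunct2, THEN conjunct2,
          rule_format]) (use l m q in auto)
  then obtain E where E: "proj_plane E" and subs: "\<forall>U\<in>{isect L l n, isect L l (shift m n),
      isect L l (shift q (shift m n)), isect L l (shift q n)}. U \<subseteq> E"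
    unfolding coplanar_subspaces_def by blast
  have isect_E: "isect L l s \<subseteq> E" if "s \<in> ?S" for s
    using that by (elim insertE emptyE; hypsubst) (rule subs[rule_format], simp)+
  obtain \<phi> where \<phi>: "\<And>x y. \<phi> (x + y) = \<phi> x + \<phi> y" "\<And>a x. \<phi> (a *s x) = a * \<phi> x"
    and ker: "E = {x. \<phi> x = 0}"
    using proj_plane_kernel[OF E] by metis
  have "\<exists>k. \<forall>u. \<phi> (line_point (D s) u) = k * det2 u (meet l s)" if s: "s \<in> ?S" for s
  proof -
    have "line_point (D s) (meet l s) \<in> E"
      using isect_E[OF s] unfolding isect_meet[OF l] by (simp add: subset_iff vec.span_base)
    then have "\<phi> (line_point (D s) (meet l s)) = 0" using ker by simp
    then show ?thesis
      using line_point_functional[OF \<phi> _ line_point_meet_nonzero[OF l]] by metis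
  qed
  then obtain \<kappa> where \<kappa>: "\<And>s u. s \<in> ?S \<Longrightarrow> \<phi> (line_point (D s) u) = \<kappa> s * det2 u (meet l s)"
    by metis
  \<comment> \<open>Neighbouring lines share a corner, where the functional has only one value.\<close>
  have edge: "\<kappa> s = \<kappa> (shift r s) * ratio l r s"
    if "s \<in> ?S" "shift r s \<in> ?S" "r \<in> {1, 2, 3} - {l}" for s r
  proof -
    have "\<kappa> s * det2 (meet r s) (meet l s) = \<kappa> (shift r s) * det2 (meet r s) (meet l (shift r s))"
      using \<kappa>[OF that(1), of "meet r s"] \<kappa>[OF that(2), of "meet r s"] line_point_meet_shift[of r s] that(3)
      by simp
    then have "\<kappa> s * det2 (meet l s) (meet r s) = \<kappa> (shift r s) * det2 (meet l (shift r s)) (meet r s)"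
      by (simp add: det2_def algebra_simps)
    then show ?thesis using det2_meet_meet[OF l that(3), of s] by (simp add: ratio_def field_simps)
  qed
  have S: "n \<in> ?S" "shift m n \<in> ?S" "shift q n \<in> ?S" "shift q (shift m n) \<in> ?S"
    by simp_all
  have m': "m \<in> {1, 2, 3} - {l}" and q': "q \<in> {1, 2, 3} - {l}" using m q by auto
  have edges: "\<kappa> n = \<kappa> (shift m n) * ratio l m n" "\<kappa> n = \<kappa> (shift q n) * ratio l q n"
    "\<kappa> (shift m n) = \<kappa> (shift q (shift m n)) * ratio l q (shift m n)"
    "\<kappa> (shift q n) = \<kappa> (shift q (shift m n)) * ratio l m (shift q n)"
    using edge[OF S(1,2) m'] edge[OF S(1,3) q'] edge[OF S(2,4) q']
      edge[OF S(3) _ m', unfolded shift_commute[of m q], OF S(4)] by blast+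
  \<comment> \<open>A zero of \<open>\<kappa>\<close> would spread around the face and put all four lines into the plane.\<close>
  have "\<kappa> (shift q (shift m n)) \<noteq> 0"
  proof
    assume "\<kappa> (shift q (shift m n)) = 0"
    then have zero: "\<kappa> s = 0" if "s \<in> ?S" for s using edges that by auto
    have "L s \<subseteq> E" if s: "s \<in> ?S" for s
    proof -
      have "\<phi> (line_point (D s) u) = 0" for u using \<kappa>[OF s] zero[OF s] by simp
      then show ?thesis unfolding lift ker by auto
    qed
    then have "coplanar_subspaces {L n, L (shift m n), L (shift q n), L (shift q (shift m n))}"
      using E unfolding coplanar_subspaces_def by blast
    moreover have "\<not> coplanar_subspaces {L n, L (shift m n), L (shift q n), L (shift q (shift m n))}"
      by (rule generic[unfolded general_position_def, THEN conjunct2, THEN conjunct2, THEN conjunct1,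
            rule_format]) (use m q in auto)
    ultimately show False by blast
  qed
  moreover have "\<kappa> (shift q (shift m n)) * (ratio l m n * ratio l q (shift m n))
      = \<kappa> (shift q (shift m n)) * (ratio l q n * ratio l m (shift q n))"
    using edges by (metis mult.assoc mult.commute)
  ultimately show ?thesis by simp
qed

text \<open>
  Multiplying the representatives by a potential for the inverse ratios normalises all
  determinants at once; equality of determinants with \<open>V\<^sup>m\<close> then means that \<open>V\<^sup>l\<^sub>m\<close> and \<open>V\<^sup>l\<close>
  differ by a multiple of \<open>V\<^sup>m\<close>.
\<close>

lemma wave_functions_exist: "\<exists>V W c. wave_functions D V W c"
proof -
  have ratio_nonzero: "ratio l m n \<noteq> 0" if "l \<in> {1, 2, 3}" "m \<in> {1, 2, 3} - {l}" for l m n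
    using det2_meet_meet det2_meet_shift_meet that by (simp add: ratio_def)
  have "\<exists>g. (\<forall>n. g n \<noteq> 0) \<and>
      (\<forall>m n. m \<in> {1, 2, 3} - {l} \<longrightarrow> g (shift m n) = inverse (ratio l m n) * g n)"
    if l: "l \<in> {1, 2, 3}" for l
  proof -
    have "inverse (ratio l m n) * inverse (ratio l q (shift m n))
        = inverse (ratio l q n) * inverse (ratio l m (shift q n))"
      if "m \<in> {1, 2, 3} - {l}" "q \<in> {1, 2, 3} - {l, m}" for m q n
      using ratio_closed[OF l that] by (metis inverse_mult_distrib)
    then show ?thesis
      using nonzero_potential[of l "\<lambda>m n. inverse (ratio l m n)"] ratio_nonzero l
      by (metis inverse_nonzero_iff_nonzero)
  qed
  then obtain g where g_nonzero: "\<And>l n. l \<in> {1, 2, 3} \<Longrightarrow> g l n \<noteq> 0"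
    and g: "\<And>l m n. l \<in> {1, 2, 3} \<Longrightarrow> m \<in> {1, 2, 3} - {l} \<Longrightarrow>
      g l (shift m n) = inverse (ratio l m n) * g l n"
    by metis
  define V where "V l n k = g l n * meet l n k" for l n k
  have det2_V: "det2 (V l n) (V m n') = g l n * g m n' * det2 (meet l n) (meet m n')" for l m n n'
    by (simp add: V_def det2_def algebra_simps)
  have V_indep: "det2 (V l n) (V m n) \<noteq> 0" "det2 (V l (shift m n)) (V m (shift l n)) \<noteq> 0"
    if "l \<in> {1, 2, 3}" "m \<in> {1, 2, 3} - {l}" for l m n
    using that g_nonzero det2_meet_meet[OF that] det2_meet_shift_meet_shift[OF that] by (auto simp: det2_V)
  have "\<exists>c. \<forall>k\<in>{4, 5}. V l (shift m n) k = V l n k - c * V m n k"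
    if "l \<in> {1, 2, 3}" "m \<in> {1, 2, 3} - {l}" for l m n
  proof (rule det2_eq_imp_shear)
    show "det2 (V l (shift m n)) (V m n) = det2 (V l n) (V m n)"
      using g[OF that, of n] det2_meet_meet[OF that, of n] det2_meet_shift_meet[OF that, of n]
      by (simp add: det2_V ratio_def)
  qed (rule V_indep[OF that])
  then obtain c where c: "\<And>l m n k. l \<in> {1, 2, 3} \<Longrightarrow> m \<in> {1, 2, 3} - {l} \<Longrightarrow> k \<in> {4, 5} \<Longrightarrow>
      V l (shift m n) k = V l n k - c l m n * V m n k"
    by metis
  have "\<exists>w. \<forall>i\<in>{4, 5}. \<forall>k\<in>{4, 5}. D (shift l n) i k = D n i k - w i * V l n k"
    if l: "l \<in> {1, 2, 3}" for l n
  proof (rule rank_one_difference)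
    have V: "line_point (D s) (V l n) = g l n *s line_point (D s) (meet l n)" for s
      unfolding line_point_scale[symmetric] V_def ..
    show "line_point (D n) (V l n) = line_point (D (shift l n)) (V l n)"
      using line_point_meet_shift[OF l] by (simp add: V)
    show "line_point (D n) (V l n) \<noteq> 0"
      using line_point_meet_nonzero[OF l] g_nonzero[OF l] by (simp add: V)
  qed
  then obtain W where W: "\<And>l n i k. l \<in> {1, 2, 3} \<Longrightarrow> i \<in> {4, 5} \<Longrightarrow> k \<in> {4, 5} \<Longrightarrow>
      D (shift l n) i k = D n i k - W l n i * V l n k"
    by metis
  have "wave_functions D V W c"
    unfolding wave_functions_def by (intro conjI ballI allI W c V_indep)
  then show ?thesis by blast
qed

end

section \<open>The normalised lift solves the M-system\<close>

lemma normalised_lift_iff: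
  "normalised_lift L M44 M45 M54 M55 \<longleftrightarrow>
    (\<forall>n. L n = range (line_point (\<lambda>i k. if i = 4 then if k = 4 then M44 n else M45 n
      else if k = 4 then M54 n else M55 n)))"
  unfolding normalised_lift_def span_normalised_pair[symmetric] by simp

theorem theorem4p7:
  fixes L :: "lattice \<Rightarrow> (complex ^ 4) set"
  assumes "fundamental_line_complex L"
    and "general_position L"
  shows "(\<exists>!(M44, M45, M54, M55). normalised_lift L M44 M45 M54 M55) \<and>
    (\<forall>M44 M45 M54 M55. normalised_lift L M44 M45 M54 M55 \<longrightarrow>
      (\<exists>M. M_system M \<and> M 4 4 = M44 \<and> M 4 5 = M45 \<and> M 5 4 = M54 \<and> M 5 5 = M55))"
proof (intro conjI allI impI)
  have "\<forall>n. proj_line (L n)" "\<forall>n. L n \<inter> {x. x $ 1 = 0 \<and> x $ 2 = 0} = {0}"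
    using assms by (simp_all only: fundamental_line_complex_def general_position_def simp_thms)
  then have "\<forall>n. \<exists>D. L n = range (line_point D)"
    using proj_line_eq_range_line_point by blast
  then obtain D where D: "\<And>n. L n = range (line_point (D n))" by metis
  have "line_point (\<lambda>i k. if i = 4 then if k = 4 then D n 4 4 else D n 4 5
      else if k = 4 then D n 5 4 else D n 5 5) = line_point (D n)" for n
    by (simp add: fun_eq_iff line_point_def)
  then have lift: "normalised_lift L (\<lambda>n. D n 4 4) (\<lambda>n. D n 4 5) (\<lambda>n. D n 5 4) (\<lambda>n. D n 5 5)"
    by (simp add: normalised_lift_iff D)
  have unique: "M44 = (\<lambda>n. D n 4 4) \<and> M45 = (\<lambda>n. D n 4 5) \<and> M54 = (\<lambda>n. D n 5 4) \<and>
      M55 = (\<lambda>n. D n 5 5)" if M: "normalised_lift L M44 M45 M54 M55" for M44 M45 M54 M55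
  proof -
    let ?D = "\<lambda>n i k. if i = (4 :: nat) then if k = (4 :: nat) then M44 n else M45 n
      else if k = 4 then M54 n else M55 n"
    have "?D n i k = D n i k" if "i \<in> {4, 5}" "k \<in> {4, 5}" for n i k
    proof (rule range_line_point_inject)
      show "range (line_point (?D n)) = range (line_point (D n))"
        using M unfolding normalised_lift_iff D by blast
    qed (use that in auto)
    from this[of 4 4] this[of 4 5] this[of 5 4] this[of 5 5] show ?thesis by auto
  qed
  show "\<exists>!(M44, M45, M54, M55). normalised_lift L M44 M45 M54 M55"
    using lift by (intro ex1I[of _ "(\<lambda>n. D n 4 4, \<lambda>n. D n 4 5, \<lambda>n. D n 5 4, \<lambda>n. D n 5 5)"])
      (auto dest: unique)
  interpret lifted_line_complex L D
    using assms D by unfold_locales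
  obtain M where M: "M_system M" "\<And>i k n. i \<in> {4, 5} \<Longrightarrow> k \<in> {4, 5} \<Longrightarrow> M i k n = D n i k"
    using wave_functions_exist M_system_from_wave_functions by metis
  fix M44 M45 M54 M55 assume "normalised_lift L M44 M45 M54 M55"
  moreover have "M i k = (\<lambda>n. D n i k)" if "i \<in> {4, 5}" "k \<in> {4, 5}" for i k
    using M(2)[OF that] by (rule ext)
  ultimately have "M 4 4 = M44 \<and> M 4 5 = M45 \<and> M 5 4 = M54 \<and> M 5 5 = M55"
    using unique by simp
  then show "\<exists>M. M_system M \<and> M 4 4 = M44 \<and> M 4 5 = M45 \<and> M 5 4 = M54 \<and> M 5 5 = M55"
    using M(1) by blast
qed

end
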